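(* Let $G=\mathrm{Sym}(m)$ with $m\geq 5$, let $X=X^{-1}$ be a nonempty proper subset of $G\setminus\mathrm{Soc}(G)$ which is normal in $G$ (i.e. $X^g=X$ for all $g\in G$), and let $\Gamma=\mathrm{Cay}(G,X)$. Then the number of pairwise nonequivalent central Cayley representations of $\Gamma$ over $G$ is at least $\left[\frac{m}{4}\right]$.
   Context: Here $\mathrm{Soc}(G)=\mathrm{Alt}(m)$ and $[\cdot]$ denotes the integer part. For a finite group $G$ and $X\subseteq G$ not containing the identity, $\mathrm{Cay}(G,X)$ is the directed graph with vertex set $G$ and arc set $\{(g,xg): g\in G,\ x\in X\}$; it is central if $X^g=X$ for every $g\in G$. A Cayley representation of a graph $\Gamma$ over $G$ is a Cayley graph over $G$ isomorphic to $\Gamma$. Two Cayley representations over $G$ are equivalent if there is a group automorphism of $G$ which is at the same time an isomorphism between the two Cayley graphs. Central Cayley representations are Cayley representations of central Cayley graphs: since $\Gamma$ is a central Cayley graph over $G$, all Cayley graphs over $G$ isomorphic to $\Gamma$ are counted (up to equivalence). *)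

theory Defs
  imports
    "HOL-Algebra.Sym_Groups"
    "Graph_Theory.Digraph_Isomorphism"
    "Graph_Theory.Pair_Digraph"
begin

definition minimal_normal_subgroup :: "'a set \<Rightarrow> ('a, 'b) monoid_scheme \<Rightarrow> bool" where
  "minimal_normal_subgroup N G \<longleftrightarrow>
     N \<lhd> G \<and> N \<noteq> {\<one>\<^bsub>G\<^esub>} \<and>
     (\<forall>K. K \<lhd> G \<longrightarrow> K \<subseteq> N \<longrightarrow> K = {\<one>\<^bsub>G\<^esub>} \<or> K = N)"

(* The subgroup generated by all minimal normal subgroups; it is the alternating group
   when G = sym_group m with m \<ge> 5. *)
definition socle :: "('a, 'b) monoid_scheme \<Rightarrow> 'a set" where
  "socle G = generate G (\<Union>{N. minimal_normal_subgroup N G})"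

definition normal_subset :: "'a set \<Rightarrow> ('a, 'b) monoid_scheme \<Rightarrow> bool" where
  "normal_subset X G \<longleftrightarrow>
     X \<subseteq> carrier G \<and>
     (\<forall>g \<in> carrier G. (\<lambda>x. inv\<^bsub>G\<^esub> g \<otimes>\<^bsub>G\<^esub> x \<otimes>\<^bsub>G\<^esub> g) ` X = X)"

definition cayley_digraph :: "('a, 'b) monoid_scheme \<Rightarrow> 'a set \<Rightarrow> 'a pair_pre_digraph" where
  "cayley_digraph G X =
     \<lparr> pverts = carrier G,
       parcs = {(g, x \<otimes>\<^bsub>G\<^esub> g) | g x. g \<in> carrier G \<and> x \<in> X} \<rparr>"

(* Y ranges over all connection sets, not only over the normal ones: a Cayley representation
   of \<Gamma> is called central when \<Gamma> itself is (isomorphic to) a central Cayley graph, which is a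
   hypothesis on \<Gamma> and puts no constraint on Y. *)
definition cayley_representations ::
  "('a, 'b) monoid_scheme \<Rightarrow> 'v pair_pre_digraph \<Rightarrow> 'a pair_pre_digraph set" where
  "cayley_representations G \<Gamma> =
     {cayley_digraph G Y | Y.
        Y \<subseteq> carrier G - {\<one>\<^bsub>G\<^esub>} \<and>
        digraph_iso (with_proj (cayley_digraph G Y)) (with_proj \<Gamma>)}"

definition cayley_equivalent ::
  "('a, 'b) monoid_scheme \<Rightarrow> 'a pair_pre_digraph \<Rightarrow> 'a pair_pre_digraph \<Rightarrow> bool" where
  "cayley_equivalent G \<Delta> \<Delta>' \<longleftrightarrow>
     (\<exists>f. iso_verts f \<in> iso G G \<and>
          pre_digraph.digraph_isomorphism (with_proj \<Delta>) f \<and>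
          with_proj \<Delta>' = app_iso f (with_proj \<Delta>))"

definition cayley_equivalence ::
  "('a, 'b) monoid_scheme \<Rightarrow> 'v pair_pre_digraph \<Rightarrow> 'a pair_pre_digraph rel" where
  "cayley_equivalence G \<Gamma> =
     {(\<Delta>, \<Delta>'). \<Delta> \<in> cayley_representations G \<Gamma> \<and> \<Delta>' \<in> cayley_representations G \<Gamma> \<and>
               cayley_equivalent G \<Delta> \<Delta>'}"

end

theory Submission
  imports Defs
begin

text \<open>
  The socle contains the alternating group, so \<open>X\<close> consists of odd permutations. This allows many
  translates of \<open>X\<close> as connection sets of the same graph: for every even involution \<open>t\<close>, the
  permutation of \<open>G\<close> that fixes the even elements and multiplies the odd ones by \<open>t\<close> on the left is
  an isomorphism from \<open>Cay(G, tX)\<close> to \<open>Cay(G, X)\<close> (\<open>cayley_digraph_translate_iso\<close>).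

  Inequivalence of such representations rests on rigidity. The permutations \<open>z\<close> with \<open>zX = X\<close> form
  a normal subgroup that does not contain the alternating group, since \<open>X\<close> is not the set of all
  odd permutations. For \<open>m \<ge> 5\<close> that subgroup is trivial. Consequently a set \<open>sX = uX'\<close> with \<open>X\<close>
  and \<open>X'\<close> normal determines its translating permutation, \<open>s = u\<close>
  (\<open>translate_of_normal_subset_unique\<close>), and every automorphism carrying \<open>sX\<close> onto \<open>tX\<close> must carry
  \<open>s\<close> to \<open>t\<close>.

  The involutions used are the products of \<open>2j\<close> disjoint transpositions with \<open>1 \<le> j \<le> m div 4\<close>.
  For \<open>m < 8\<close> there is at most one of them. For \<open>m \<ge> 8\<close>, automorphisms map transpositions to
  transpositions, because the transpositions are the only class of involutions in which the
  product of any two elements has order at most 3 (\<open>sym_group_iso_transpose\<close>). They therefore preserve the least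
  number of transpositions needed to write a permutation, which is \<open>2j\<close> for the involution with
  index \<open>j\<close>. So no automorphism maps one of these involutions to another.
\<close>

section \<open>Normal subgroups and the socle of the symmetric group\<close>

lemma permutes_conj_transpose:
  assumes "g permutes S"
  shows "g \<circ> transpose a b \<circ> inv' g = transpose (g a) (g b)"
proof -
  have "bij g" using assms by (rule permutes_bij)
  then have "transpose (g a) (g b) \<circ> g = g \<circ> transpose a b"
    by (auto simp: fun_eq_iff transpose_def bij_def inj_eq)
  then show ?thesis
    using permutes_inv_o(1)[OF assms] by (metis comp_assoc comp_id)
qed

lemma sym_group_normal_conj:
  assumes "N \<lhd> sym_group m" "n \<in> N" "g permutes {1..m}"
  shows "g \<circ> n \<circ> inv' g \<in> N"
  using assms group.normal_inv_iff[OF sym_group_is_group, of N m]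
  by (metis sym_group_carrier sym_group_inv_equality sym_group_mult)

lemma sym_group_subgroup_comp:
  assumes "subgroup N (sym_group m)" "p \<in> N" "q \<in> N"
  shows "p \<circ> q \<in> N"
  using subgroup.m_closed[OF assms] by (simp add: sym_group_mult)

lemma exists_fresh_point_list:
  fixes xs :: "nat list"
  assumes "length xs < m"
  obtains x where "x \<in> {1..m}" "x \<notin> set xs"
proof -
  have "\<not> {1..m} \<subseteq> set xs"
    using assms card_mono[of "set xs" "{1..m}"] card_length[of xs] by auto
  then show ?thesis using that by (meson subsetI)
qed

text \<open>The commutator of \<open>n \<in> N\<close> with a transposition lies in \<open>N\<close> and is a product of two
  transpositions. If these overlap, it is a 3-cycle. If they are disjoint, multiplying it by a
  conjugate that shares one of them leaves a 3-cycle; this uses a fifth point.\<close>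

lemma normal_subgroup_three_cycle:
  assumes N: "N \<lhd> sym_group m" and "m \<ge> 5" and "N \<noteq> {id}"
  obtains x y z where "x \<in> {1..m}" "y \<in> {1..m}" "z \<in> {1..m}" "distinct [x, y, z]"
    "transpose x y \<circ> transpose y z \<in> N"
proof -
  have sub: "subgroup N (sym_group m)" by (rule normal_imp_subgroup[OF N])
  have "id \<in> N" using subgroup.one_closed[OF sub] by (simp add: sym_group_one)
  then obtain n where n: "n \<in> N" "n \<noteq> id" using assms(3) by blast
  have np: "n permutes {1..m}"
    using subgroup.mem_carrier[OF sub n(1)] by (simp add: sym_group_carrier)
  obtain a where a: "n a \<noteq> a" using n(2) by (auto simp: fun_eq_iff)
  have aI: "a \<in> {1..m}" using a np by (auto simp: permutes_def)
  define b where "b = n a"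
  have bI: "b \<in> {1..m}" using permutes_in_image[OF np] aI by (simp add: b_def)
  \<comment> \<open>Avoiding the preimage of \<open>a\<close> makes \<open>n c\<close> different from \<open>a\<close>, so that the two
    transpositions of the commutator meet at most in \<open>c\<close>.\<close>
  obtain c where c: "c \<in> {1..m}" "c \<notin> set [a, b, inv' n a]"
    using exists_fresh_point_list[of "[a, b, inv' n a]" m] assms(2) by auto
  define e where "e = n c"
  have eI: "e \<in> {1..m}" using permutes_in_image[OF np] c by (simp add: e_def)
  have ea: "e \<noteq> a" using c permutes_inverses(2)[OF np, of c] by (auto simp: e_def)
  have eb: "e \<noteq> b" using c permutes_inj[OF np] by (auto simp: e_def b_def inj_eq)
  have ab: "a \<noteq> b" using a by (simp add: b_def)
  have tp: "transpose a c permutes {1..m}" using aI c by (simp add: permutes_swap_id)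
  have "transpose a c \<circ> inv' n \<circ> inv' (transpose a c) \<in> N"
    using subgroup.m_inv_closed[OF sub n(1)] np
    by (intro sym_group_normal_conj[OF N _ tp]) (simp add: sym_group_carrier)
  then have "n \<circ> (transpose a c \<circ> inv' n \<circ> inv' (transpose a c)) \<in> N"
    by (rule sym_group_subgroup_comp[OF sub n(1)])
  moreover have "n \<circ> (transpose a c \<circ> inv' n \<circ> inv' (transpose a c)) = transpose b e \<circ> transpose a c"
    using permutes_conj_transpose[OF np, of a c] by (simp add: b_def e_def comp_assoc[symmetric])
  ultimately have mem: "transpose b e \<circ> transpose a c \<in> N" by simp
  show ?thesis
  proof (cases "e = c")
    case True
    then have "transpose b c \<circ> transpose c a \<in> N" using mem by (simp add: transpose_commute)
    then show ?thesis using that[of b c a] aI bI c ab by auto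
  next
    case False
    obtain f where f: "f \<in> {1..m}" "f \<notin> set [a, b, c, e]"
      using exists_fresh_point_list[of "[a, b, c, e]" m] assms(2) by auto
    have fp: "transpose c f permutes {1..m}" using f c by (simp add: permutes_swap_id)
    have "transpose c f \<circ> (transpose b e \<circ> transpose a c) \<circ> inv' (transpose c f) \<in> N"
      by (rule sym_group_normal_conj[OF N mem fp])
    then have "(transpose b e \<circ> transpose a c)
        \<circ> (transpose c f \<circ> (transpose b e \<circ> transpose a c) \<circ> inv' (transpose c f)) \<in> N"
      by (rule sym_group_subgroup_comp[OF sub mem])
    moreover have "(transpose b e \<circ> transpose a c)
        \<circ> (transpose c f \<circ> (transpose b e \<circ> transpose a c) \<circ> inv' (transpose c f))
        = transpose c a \<circ> transpose a f"
    proof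
      fix v
      have "distinct [a, b, c, e, f]" using f c False ea eb ab by auto
      then show "((transpose b e \<circ> transpose a c)
          \<circ> (transpose c f \<circ> (transpose b e \<circ> transpose a c) \<circ> inv' (transpose c f))) v
        = (transpose c a \<circ> transpose a f) v"
        by (cases "v \<in> {a, b, c, e, f}") auto
    qed
    ultimately show ?thesis using that[of c a f] aI c f by auto
  qed
qed

text \<open>The 3-cycle on \<open>x\<close>, \<open>y\<close>, \<open>z\<close> is conjugated to the one on \<open>a\<close>, \<open>b\<close>, \<open>c\<close> by three
  transpositions, each of which puts one point into place and keeps those already placed.\<close>

lemma normal_subgroup_all_three_cycles:
  assumes N: "N \<lhd> sym_group m"
    and xyz: "{x, y, z} \<subseteq> {1..m}" "distinct [x, y, z]" "transpose x y \<circ> transpose y z \<in> N"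
    and abc: "{a, b, c} \<subseteq> {1..m}" "distinct [a, b, c]"
  shows "transpose a b \<circ> transpose b c \<in> N"
proof -
  have move: "transpose (g x) (g y) \<circ> transpose (g y) (g z) \<in> N"
    if "transpose x y \<circ> transpose y z \<in> N" "g permutes {1..m}" for g x y z
  proof -
    have "g \<circ> (transpose x y \<circ> transpose y z) \<circ> inv' g \<in> N"
      by (rule sym_group_normal_conj[OF N that])
    also have "g \<circ> (transpose x y \<circ> transpose y z) \<circ> inv' g
        = (g \<circ> transpose x y \<circ> inv' g) \<circ> (g \<circ> transpose y z \<circ> inv' g)"
      using permutes_inverses(2)[OF that(2)] by (simp add: fun_eq_iff)
    finally show ?thesis by (simp only: permutes_conj_transpose[OF that(2)])
  qed
  define y1 where "y1 = transpose x a y"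
  define z1 where "z1 = transpose x a z"
  define z2 where "z2 = transpose y1 b z1"
  have 1: "distinct [a, y1, z1]" "{y1, z1} \<subseteq> {1..m}" "transpose a y1 \<circ> transpose y1 z1 \<in> N"
    using xyz abc move[OF xyz(3), of "transpose x a"]
    by (auto simp: y1_def z1_def permutes_swap_id transpose_def)
  have 2: "distinct [a, b, z2]" "z2 \<in> {1..m}" "transpose a b \<circ> transpose b z2 \<in> N"
    using 1 abc move[OF 1(3), of "transpose y1 b"]
    by (auto simp: z2_def permutes_swap_id transpose_def split: if_splits)
  show ?thesis
    using 2 abc move[OF 2(3), of "transpose z2 c"]
    by (auto simp: permutes_swap_id transpose_def split: if_splits)
qed

lemma alt_group_subset_normal_subgroup:
  assumes N: "N \<lhd> sym_group m" and m: "m \<ge> 5" and nontriv: "N \<noteq> {id}"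
  shows "carrier (alt_group m) \<subseteq> N"
proof
  have sub: "subgroup N (sym_group m)" by (rule normal_imp_subgroup[OF N])
  have tc: "three_cycles m \<subseteq> N"
  proof
    fix p assume "p \<in> three_cycles m"
    then obtain cs where cs: "p = cycle_of_list cs" "distinct cs" "length cs = 3" "set cs \<subseteq> {1..m}"
      by auto
    then obtain a b c where cs_eq: "cs = [a, b, c]"
      by (auto simp: eval_nat_numeral length_Suc_conv)
    obtain x y z where xyz: "{x, y, z} \<subseteq> {1..m}" "distinct [x, y, z]"
      "transpose x y \<circ> transpose y z \<in> N"
      using normal_subgroup_three_cycle[OF N m nontriv] by (metis empty_subsetI insert_subset)
    then have "transpose a b \<circ> transpose b c \<in> N"
      using normal_subgroup_all_three_cycles[OF N xyz, of a b c] cs cs_eq by simp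
    then show "p \<in> N" using cs cs_eq by simp
  qed
  fix p assume "p \<in> carrier (alt_group m)"
  then have "p \<in> generate (alt_group m) (three_cycles m)"
    by (simp only: alt_group_carrier_as_three_cycles)
  then show "p \<in> N"
  proof (induction rule: generate.induct)
    case one
    then show ?case using subgroup.one_closed[OF sub] by (simp only: alt_group_one sym_group_one)
  next
    case (incl h)
    then show ?case using tc by auto
  next
    case (inv h)
    then have "h \<in> carrier (alt_group m)" "h \<in> N" using three_cycles_incl tc by blast+
    then show ?case
      using subgroup.m_inv_closed[OF sub, of h]
      by (simp add: alt_group_inv_equality sym_group_carrier alt_group_carrier)
  next
    case (eng h1 h2)
    then show ?case using sym_group_subgroup_comp[OF sub] by (simp only: alt_group_mult)
  qed
qed

text \<open>A normal subgroup of the symmetric group inside the alternating group is trivial or the whole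
  alternating group, so the alternating group is one of the minimal normal subgroups that
  generate the socle.\<close>

lemma alt_group_subset_socle:
  assumes "m \<ge> 5"
  shows "carrier (alt_group m) \<subseteq> socle (sym_group m)"
proof -
  have normal: "carrier (alt_group m) \<lhd> sym_group m"
    using group_hom.normal_kernel[OF sign_group_hom] by (simp add: alt_group_is_sign_kernel)
  have "transpose 1 2 \<circ> transpose 2 (3::nat) \<in> carrier (alt_group m)"
    using assms
    by (auto simp: alt_group_carrier evenperm_comp permutation_swap_id evenperm_swap
        intro!: permutes_compose permutes_swap_id)
  moreover have "transpose 1 2 \<circ> transpose 2 (3::nat) \<noteq> id"
    by (auto simp: fun_eq_iff transpose_def intro!: exI[of _ 1])
  ultimately have "carrier (alt_group m) \<noteq> {id}" by blast
  moreover have "K = {id} \<or> K = carrier (alt_group m)"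
    if "K \<lhd> sym_group m" "K \<subseteq> carrier (alt_group m)" for K
    using alt_group_subset_normal_subgroup[OF that(1) assms] that(2) by blast
  ultimately have "minimal_normal_subgroup (carrier (alt_group m)) (sym_group m)"
    using normal by (simp add: minimal_normal_subgroup_def sym_group_one)
  then show ?thesis
    unfolding socle_def by (auto intro: generate.incl)
qed

lemma outside_socle_odd:
  assumes "m \<ge> 5" and "x \<in> carrier (sym_group m) - socle (sym_group m)"
  shows "x permutes {1..m} \<and> \<not> evenperm x"
proof -
  have "x \<notin> carrier (alt_group m)" using alt_group_subset_socle[OF assms(1)] assms(2) by blast
  then show ?thesis using assms(2) by (simp add: sym_group_carrier alt_group_carrier)
qed

section \<open>Translates of normal subsets\<close>

lemma normal_subset_conj:
  assumes X: "normal_subset X (sym_group m)" and "x \<in> X" and g: "g permutes {1..m}"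
  shows "g \<circ> x \<circ> inv' g \<in> X"
proof -
  have g': "inv' g permutes {1..m}" using g by (rule permutes_inv)
  then have "(\<lambda>x. inv\<^bsub>sym_group m\<^esub> (inv' g) \<otimes>\<^bsub>sym_group m\<^esub> x \<otimes>\<^bsub>sym_group m\<^esub> inv' g) ` X = X"
    using X by (simp add: normal_subset_def sym_group_carrier)
  then have "(\<lambda>x. g \<circ> x \<circ> inv' g) ` X = X"
    using g' permutes_inv_inv[OF g] by (simp add: sym_group_mult sym_group_carrier)
  then show ?thesis using \<open>x \<in> X\<close> by blast
qed

lemma normal_subset_commute:
  assumes X: "normal_subset X (sym_group m)" and g: "g permutes {1..m}"
  shows "(\<circ>) g ` X = (\<lambda>x. x \<circ> g) ` X"
proof
  show "(\<circ>) g ` X \<subseteq> (\<lambda>x. x \<circ> g) ` X"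
  proof
    fix y assume "y \<in> (\<circ>) g ` X"
    then obtain x where "x \<in> X" "y = g \<circ> x" by blast
    then have "y = (g \<circ> x \<circ> inv' g) \<circ> g" "g \<circ> x \<circ> inv' g \<in> X"
      using normal_subset_conj[OF X _ g] by (simp_all add: comp_assoc permutes_inv_o(2)[OF g])
    then show "y \<in> (\<lambda>x. x \<circ> g) ` X" by blast
  qed
  show "(\<lambda>x. x \<circ> g) ` X \<subseteq> (\<circ>) g ` X"
  proof
    fix y assume "y \<in> (\<lambda>x. x \<circ> g) ` X"
    then obtain x where "x \<in> X" "y = x \<circ> g" by blast
    then have "y = g \<circ> (inv' g \<circ> x \<circ> inv' (inv' g))" "inv' g \<circ> x \<circ> inv' (inv' g) \<in> X"
      using normal_subset_conj[OF X _ permutes_inv[OF g]]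
      by (simp_all add: comp_assoc[symmetric] permutes_inv_o(1)[OF g] permutes_inv_inv[OF g])
    then show "y \<in> (\<circ>) g ` X" by blast
  qed
qed

definition left_stabilizer :: "nat \<Rightarrow> (nat \<Rightarrow> nat) set \<Rightarrow> (nat \<Rightarrow> nat) set" where
  "left_stabilizer m X = {z. z permutes {1..m} \<and> (\<circ>) z ` X = X}"

lemma left_stabilizer_subgroup: "subgroup (left_stabilizer m X) (sym_group m)"
proof (rule group.subgroupI[OF sym_group_is_group])
  show "left_stabilizer m X \<subseteq> carrier (sym_group m)"
    by (auto simp: left_stabilizer_def sym_group_carrier)
  show "left_stabilizer m X \<noteq> {}"
    by (auto simp: left_stabilizer_def intro!: exI[of _ id])
  show "inv\<^bsub>sym_group m\<^esub> z \<in> left_stabilizer m X" if "z \<in> left_stabilizer m X" for z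
  proof -
    have z: "z permutes {1..m}" "(\<circ>) z ` X = X" using that by (auto simp: left_stabilizer_def)
    have "(\<circ>) (inv' z) ` X = (\<circ>) (inv' z) ` (\<circ>) z ` X" by (simp add: z(2))
    also have "\<dots> = X"
      by (simp add: image_image comp_assoc[symmetric] permutes_inv_o(2)[OF z(1)])
    finally show ?thesis
      using z(1) by (simp add: left_stabilizer_def sym_group_carrier permutes_inv)
  qed
  show "y \<otimes>\<^bsub>sym_group m\<^esub> z \<in> left_stabilizer m X"
    if "y \<in> left_stabilizer m X" "z \<in> left_stabilizer m X" for y z
  proof -
    have "(\<circ>) (y \<circ> z) ` X = (\<circ>) y ` (\<circ>) z ` X" by (simp add: image_image comp_assoc)
    then show ?thesis
      using that by (simp add: left_stabilizer_def sym_group_mult permutes_compose)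
  qed
qed

lemma left_stabilizer_normal:
  assumes X: "normal_subset X (sym_group m)"
  shows "left_stabilizer m X \<lhd> sym_group m"
proof -
  have "g \<circ> z \<circ> inv' g \<in> left_stabilizer m X"
    if g: "g permutes {1..m}" and z: "z \<in> left_stabilizer m X" for g z
  proof -
    have zp: "z permutes {1..m}" and zX: "(\<circ>) z ` X = X"
      using z by (auto simp: left_stabilizer_def)
    have g': "inv' g permutes {1..m}" using g by (rule permutes_inv)
    have "(\<circ>) (g \<circ> z \<circ> inv' g) ` X = (\<circ>) g ` (\<circ>) z ` (\<circ>) (inv' g) ` X"
      by (simp add: image_image comp_assoc)
    also have "\<dots> = (\<circ>) g ` (\<circ>) z ` (\<lambda>x. x \<circ> inv' g) ` X"
      by (simp only: normal_subset_commute[OF X g'])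
    also have "\<dots> = (\<circ>) g ` (\<lambda>x. x \<circ> inv' g) ` (\<circ>) z ` X"
      by (simp add: image_image comp_assoc)
    also have "\<dots> = (\<circ>) g ` (\<circ>) (inv' g) ` X"
      by (simp only: zX normal_subset_commute[OF X g'])
    also have "\<dots> = X"
      by (simp add: image_image comp_assoc[symmetric] permutes_inv_o(1)[OF g])
    finally show ?thesis
      using g g' zp by (simp add: left_stabilizer_def permutes_compose)
  qed
  then show ?thesis
    unfolding group.normal_inv_iff[OF sym_group_is_group]
    by (auto simp: left_stabilizer_subgroup sym_group_carrier sym_group_mult)
qed

text \<open>The stabilizer is a normal subgroup, so if it is nontrivial it contains the alternating group.
  Then \<open>X\<close> is a union of cosets of the alternating group; as it is nonempty and consists of odd
  permutations, it contains every odd permutation, against the strict inclusion.\<close>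

lemma left_stabilizer_trivial:
  assumes m: "m \<ge> 5" and ne: "X \<noteq> {}"
    and sub: "X \<subset> carrier (sym_group m) - socle (sym_group m)"
    and X: "normal_subset X (sym_group m)"
  shows "left_stabilizer m X = {id}"
proof (rule ccontr)
  assume "left_stabilizer m X \<noteq> {id}"
  then have alt: "carrier (alt_group m) \<subseteq> left_stabilizer m X"
    by (intro alt_group_subset_normal_subgroup left_stabilizer_normal X m)
  obtain x where x: "x \<in> X" using ne by blast
  note odd = outside_socle_odd[OF m]
  have "carrier (sym_group m) - socle (sym_group m) \<subseteq> X"
  proof
    fix y assume "y \<in> carrier (sym_group m) - socle (sym_group m)"
    then have y: "y permutes {1..m}" "\<not> evenperm y" using odd by auto
    have "x \<in> carrier (sym_group m) - socle (sym_group m)" using x sub by blast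
    then have x': "x permutes {1..m}" "\<not> evenperm x" using odd by auto
    have "permutation x" "permutation y"
      using x' y by (auto simp: permutation_permutes)
    then have "evenperm (y \<circ> inv' x)"
      using x' y by (simp add: evenperm_comp evenperm_inv permutation_inverse)
    then have "y \<circ> inv' x \<in> carrier (alt_group m)"
      using x' y by (simp add: alt_group_carrier permutes_compose permutes_inv)
    then have "(\<circ>) (y \<circ> inv' x) ` X = X" using alt by (auto simp: left_stabilizer_def)
    then have "(y \<circ> inv' x) \<circ> x \<in> X" using x by blast
    then show "y \<in> X" by (simp add: comp_assoc permutes_inv_o(2)[OF x'(1)])
  qed
  then show False using sub by blast
qed

lemma sym_group_central_is_id:
  fixes w :: "nat \<Rightarrow> nat"
  assumes m: "m \<ge> 3" and w: "w permutes {1..m}"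
    and central: "\<And>g. g permutes {1..m} \<Longrightarrow> g \<circ> w = w \<circ> g"
  shows "w = id"
proof (rule ccontr)
  assume "w \<noteq> id"
  then obtain a where a: "w a \<noteq> a" by (auto simp: fun_eq_iff)
  have aI: "a \<in> {1..m}" using a w by (auto simp: permutes_def)
  have bI: "w a \<in> {1..m}" using permutes_in_image[OF w] aI by simp
  obtain d where d: "d \<in> {1..m}" "d \<notin> set [a, w a]"
    using exists_fresh_point_list[of "[a, w a]" m] m by auto
  have "(transpose (w a) d \<circ> w) a = (w \<circ> transpose (w a) d) a"
    using central[OF permutes_swap_id[OF bI d(1)]] by simp
  then show False using a d by auto
qed

text \<open>This is the rigidity behind the count of inequivalent representations: a translate of a normal
  set determines the translating permutation. With \<open>w = u\<inverse>s\<close> one has \<open>wX = X'\<close>; conjugating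
  by \<open>g\<close> fixes both sets, so \<open>w\<close> and its conjugate differ by an element of the trivial
  stabilizer of \<open>X\<close>. Hence \<open>w\<close> is central, and the centre of the symmetric group is trivial.\<close>

lemma translate_of_normal_subset_unique:
  assumes m: "m \<ge> 3"
    and X: "normal_subset X (sym_group m)" and X': "normal_subset X' (sym_group m)"
    and stab: "left_stabilizer m X = {id}"
    and s: "s permutes {1..m}" and u: "u permutes {1..m}"
    and eq: "(\<circ>) s ` X = (\<circ>) u ` X'"
  shows "s = u"
proof -
  define w where "w = inv' u \<circ> s"
  have w: "w permutes {1..m}" using s u by (simp add: w_def permutes_compose permutes_inv)
  have wX: "(\<circ>) w ` X = X'"
  proof -
    have "(\<circ>) w ` X = (\<circ>) (inv' u) ` (\<circ>) s ` X" by (simp add: w_def image_image comp_assoc)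
    also have "\<dots> = (\<circ>) (inv' u) ` (\<circ>) u ` X'" by (simp only: eq)
    also have "\<dots> = X'" by (simp add: image_image comp_assoc[symmetric] permutes_inv_o(2)[OF u])
    finally show ?thesis .
  qed
  have "g \<circ> w = w \<circ> g" if g: "g permutes {1..m}" for g
  proof -
    have g': "inv' g permutes {1..m}" using g by (rule permutes_inv)
    have "(\<circ>) (inv' w \<circ> (g \<circ> w \<circ> inv' g)) ` X = (\<circ>) (inv' w) ` (\<circ>) g ` (\<circ>) w ` (\<circ>) (inv' g) ` X"
      by (simp add: image_image comp_assoc)
    also have "\<dots> = (\<circ>) (inv' w) ` (\<circ>) g ` (\<circ>) w ` (\<lambda>x. x \<circ> inv' g) ` X"
      by (simp only: normal_subset_commute[OF X g'])
    also have "\<dots> = (\<circ>) (inv' w) ` (\<circ>) g ` (\<lambda>x. x \<circ> inv' g) ` (\<circ>) w ` X"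
      by (simp add: image_image comp_assoc)
    also have "\<dots> = (\<circ>) (inv' w) ` (\<circ>) g ` (\<circ>) (inv' g) ` X'"
      by (simp only: wX normal_subset_commute[OF X' g'])
    also have "\<dots> = (\<circ>) (inv' w) ` X'"
      by (simp add: image_image comp_assoc[symmetric] permutes_inv_o(1)[OF g])
    also have "\<dots> = X"
      by (simp add: wX[symmetric] image_image comp_assoc[symmetric] permutes_inv_o(2)[OF w])
    finally have "inv' w \<circ> (g \<circ> w \<circ> inv' g) \<in> left_stabilizer m X"
      using g g' w by (simp add: left_stabilizer_def permutes_compose permutes_inv)
    then have "inv' w \<circ> (g \<circ> w \<circ> inv' g) = id" using stab by simp
    then have "w \<circ> (inv' w \<circ> (g \<circ> w \<circ> inv' g)) \<circ> g = w \<circ> g" by simp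
    then show ?thesis
      by (simp add: comp_assoc permutes_inv_o(2)[OF g])
         (simp add: comp_assoc[symmetric] permutes_inv_o(1)[OF w])
  qed
  then have "w = id" by (rule sym_group_central_is_id[OF m w])
  then have "u \<circ> w = u" by simp
  then show ?thesis by (simp add: w_def comp_assoc[symmetric] permutes_inv_o(1)[OF u])
qed

section \<open>Automorphisms and products of transpositions\<close>

lemma transpose_product_order:
  "(transpose a b \<circ> transpose c d) \<circ> (transpose a b \<circ> transpose c d) = id \<or>
    (transpose a b \<circ> transpose c d) \<circ> (transpose a b \<circ> transpose c d)
      \<circ> (transpose a b \<circ> transpose c d) = id"
proof -
  have three: "(transpose x y \<circ> transpose x z) \<circ> (transpose x y \<circ> transpose x z)
      \<circ> (transpose x y \<circ> transpose x z) = id"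
    if "distinct [x, y, z]" for x y z :: 'a
  proof
    fix v
    show "((transpose x y \<circ> transpose x z) \<circ> (transpose x y \<circ> transpose x z)
        \<circ> (transpose x y \<circ> transpose x z)) v = id v"
      using that by (cases "v \<in> {x, y, z}") auto
  qed
  consider "a = b \<or> c = d" | "distinct [a, b, c, d]"
    | "a = c" "b = d" | "a = d" "b = c"
    | "a = c" "distinct [a, b, d]" | "a = d" "distinct [a, b, c]"
    | "b = c" "distinct [b, a, d]" | "b = d" "distinct [b, a, c]"
    by auto
  then show ?thesis
  proof cases
    case 2
    have "((transpose a b \<circ> transpose c d) \<circ> (transpose a b \<circ> transpose c d)) v = id v" for v
      using 2 by (cases "v \<in> {a, b, c, d}") auto
    then show ?thesis by (simp add: fun_eq_iff)
  next
    case 5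
    then show ?thesis using three[of a b d] by simp
  next
    case 6
    then show ?thesis using three[of a b c] by (simp add: transpose_commute[of c d])
  next
    case 7
    then show ?thesis using three[of b a d] by (simp add: transpose_commute[of a c])
  next
    case 8
    then show ?thesis using three[of b a c] by (simp add: transpose_commute[of a d] transpose_commute[of c d])
  qed (auto simp: transpose_commute)
qed

text \<open>Two matchings superposed on the same points form paths and cycles, and the product of the
  corresponding involutions rotates along them. If \<open>u\<close> has a fixed point \<open>e\<close> besides the 2-cycles
  \<open>(a b)\<close> and \<open>(c d)\<close>, a conjugate of \<open>u\<close> completes these to a path on five vertices, and the
  product has a 5-cycle. Otherwise there are four 2-cycles, which a conjugate completes to an
  octagon, and the product has a 4-cycle. Three 2-cycles would not be enough: in \<open>Sym(6)\<close> any two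
  products of three disjoint transpositions have a product of order at most 3, and the outer
  automorphism exchanges this class with the transpositions.\<close>

lemma involution_with_conjugate_product_order_ge_4:
  fixes u :: "nat \<Rightarrow> nat"
  assumes m: "m \<ge> 8" and u: "u permutes {1..m}" and inv: "u \<circ> u = id" and "u \<noteq> id"
    and not_transpose: "\<And>a b. a \<noteq> b \<Longrightarrow> u \<noteq> transpose a b"
  obtains g w where "g permutes {1..m}" "w = u \<circ> (g \<circ> u \<circ> inv' g)" "w \<circ> w \<noteq> id" "w \<circ> w \<circ> w \<noteq> id"
proof -
  have uu: "u (u x) = x" for x using inv by (metis comp_apply id_apply)
  have uI: "u x \<in> {1..m} \<longleftrightarrow> x \<in> {1..m}" for x by (rule permutes_in_image[OF u])
  have out: "x \<in> {1..m}" if "u x \<noteq> x" for x using that u by (auto simp: permutes_def)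
  obtain a where a: "u a \<noteq> a" using \<open>u \<noteq> id\<close> by (auto simp: fun_eq_iff)
  define b where "b = u a"
  have ab: "u a = b" "u b = a" "a \<noteq> b" using a uu by (auto simp: b_def)
  obtain c where c: "u c \<noteq> transpose a b c" using not_transpose[OF ab(3)] by (auto simp: fun_eq_iff)
  define d where "d = u c"
  have "c \<notin> {a, b}" using c ab by auto
  then have cd: "u c = d" "u d = c" "distinct [a, b, c, d]"
    using c ab uu by (auto simp: d_def)
  have I: "a \<in> {1..m}" "b \<in> {1..m}" "c \<in> {1..m}" "d \<in> {1..m}"
    using out ab cd by auto
  show ?thesis
  proof (cases "\<exists>e \<in> {1..m}. u e = e")
    case True
    then obtain e where e: "e \<in> {1..m}" "u e = e" by blast
    have dist: "distinct [a, b, c, d, e]" using cd ab e by auto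
    \<comment> \<open>The 2-cycles \<open>(a c)\<close> and \<open>(e d)\<close> of the conjugate link those of \<open>u\<close> into the path
      \<open>b - a - c - d - e\<close>.\<close>
    define g where "g = transpose b c \<circ> transpose c e"
    define w where "w = u \<circ> (g \<circ> u \<circ> inv' g)"
    have gp: "g permutes {1..m}"
      using I e by (simp add: g_def permutes_compose permutes_swap_id)
    have "inv' g = transpose c e \<circ> transpose b c" by (simp add: g_def o_inv_distrib)
    then have "w a = d" "w d = e" "w e = c"
      using dist ab cd e by (auto simp: w_def g_def)
    then have "(w \<circ> w) a \<noteq> a" "(w \<circ> w \<circ> w) a \<noteq> a" using dist by auto
    then show ?thesis using that[OF gp w_def] by (metis id_apply)
  next
    case False
    obtain e where e: "e \<in> {1..m}" "e \<notin> set [a, b, c, d]"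
      using exists_fresh_point_list[of "[a, b, c, d]" m] m by auto
    define f where "f = u e"
    have ef: "u e = f" "u f = e" "e \<noteq> f" using False e(1) uu unfolding f_def by metis+
    have d6: "distinct [a, b, c, d, e, f]" using cd ab ef e by auto
    obtain h where h: "h \<in> {1..m}" "h \<notin> set [a, b, c, d, e, f]"
      using exists_fresh_point_list[of "[a, b, c, d, e, f]" m] m by auto
    define k where "k = u h"
    have hk: "u h = k" "u k = h" "h \<noteq> k" using False h(1) uu unfolding k_def by metis+
    have dist: "distinct [a, b, c, d, e, f, h, k]" using d6 cd ab ef hk h by auto
    \<comment> \<open>The 2-cycles \<open>(a k)\<close>, \<open>(b c)\<close>, \<open>(d e)\<close>, \<open>(f h)\<close> of the conjugate link those of \<open>u\<close>
      into the octagon \<open>a - b - c - d - e - f - h - k - a\<close>.\<close>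
    define g where "g = transpose b k \<circ> transpose k f \<circ> transpose f d"
    define w where "w = u \<circ> (g \<circ> u \<circ> inv' g)"
    have "f \<in> {1..m}" "k \<in> {1..m}" using uI e h by (auto simp: f_def k_def)
    then have gp: "g permutes {1..m}"
      using I by (simp add: g_def permutes_compose permutes_swap_id)
    have "inv' g = transpose f d \<circ> transpose k f \<circ> transpose b k"
      by (simp add: g_def o_inv_distrib bij_comp comp_assoc)
    then have "w a = h" "w h = e" "w e = c"
      using dist ab cd ef hk by (auto simp: w_def g_def)
    then have "(w \<circ> w) a \<noteq> a" "(w \<circ> w \<circ> w) a \<noteq> a" using dist by auto
    then show ?thesis using that[OF gp w_def] by (metis id_apply)
  qed
qed

lemma sym_group_iso:
  assumes \<sigma>: "\<sigma> \<in> iso (sym_group m) (sym_group m)"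
  shows sym_group_iso_permutes: "\<And>p. p permutes {1..m} \<Longrightarrow> \<sigma> p permutes {1..m}"
    and sym_group_iso_comp: "\<And>p q. p permutes {1..m} \<Longrightarrow> q permutes {1..m} \<Longrightarrow> \<sigma> (p \<circ> q) = \<sigma> p \<circ> \<sigma> q"
    and sym_group_iso_id: "\<sigma> id = id"
    and sym_group_iso_inv: "\<And>p. p permutes {1..m} \<Longrightarrow> \<sigma> (inv' p) = inv' (\<sigma> p)"
    and sym_group_iso_eq_iff: "\<And>p q. p permutes {1..m} \<Longrightarrow> q permutes {1..m} \<Longrightarrow> \<sigma> p = \<sigma> q \<longleftrightarrow> p = q"
    and sym_group_iso_surj: "\<And>q. q permutes {1..m} \<Longrightarrow> \<exists>p. p permutes {1..m} \<and> \<sigma> p = q"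
proof -
  interpret group_hom "sym_group m" "sym_group m" \<sigma>
    using \<sigma> sym_group_is_group by (simp add: group_hom_def group_hom_axioms_def iso_def)
  have bij: "bij_betw \<sigma> (carrier (sym_group m)) (carrier (sym_group m))"
    using \<sigma> by (simp add: iso_def)
  show perm: "\<sigma> p permutes {1..m}" if "p permutes {1..m}" for p
    using hom_closed[of p] that by (simp add: sym_group_carrier)
  show "\<sigma> (p \<circ> q) = \<sigma> p \<circ> \<sigma> q" if "p permutes {1..m}" "q permutes {1..m}" for p q
    using hom_mult[of p q] that by (simp only: sym_group_carrier sym_group_mult)
  show "\<sigma> id = id" using hom_one by (simp only: sym_group_one)
  show "\<sigma> (inv' p) = inv' (\<sigma> p)" if "p permutes {1..m}" for p
    using hom_inv[of p] that perm by (simp add: sym_group_carrier)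
  show "\<sigma> p = \<sigma> q \<longleftrightarrow> p = q" if "p permutes {1..m}" "q permutes {1..m}" for p q
    using bij that by (auto simp: bij_betw_def inj_on_def sym_group_carrier)
  show "\<exists>p. p permutes {1..m} \<and> \<sigma> p = q" if "q permutes {1..m}" for q
    using bij that bij_betw_imp_surj_on[OF bij] by (metis imageE sym_group_carrier)
qed

text \<open>Any two conjugate transpositions have a product of order at most 3. An automorphism carries this
  property of the conjugacy class over to the image, and among the classes of involutions only
  the transpositions have it.\<close>

lemma sym_group_iso_transpose:
  assumes m: "m \<ge> 8" and \<sigma>: "\<sigma> \<in> iso (sym_group m) (sym_group m)"
    and ab: "a \<in> {1..m}" "b \<in> {1..m}" "a \<noteq> b"
  obtains c d where "c \<noteq> d" "\<sigma> (transpose a b) = transpose c d"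
proof -
  note perm = sym_group_iso_permutes[OF \<sigma>] and comp = sym_group_iso_comp[OF \<sigma>]
    and idim = sym_group_iso_id[OF \<sigma>] and eq_iff = sym_group_iso_eq_iff[OF \<sigma>]
  define t where "t = transpose a b"
  have t: "t permutes {1..m}" using ab by (simp add: t_def permutes_swap_id)
  have square: "\<sigma> t \<circ> \<sigma> t = id" using comp[OF t t] by (simp add: t_def idim)
  have "t a \<noteq> a" using ab by (simp add: t_def)
  then have "t \<noteq> id" by auto
  then have nontrivial: "\<sigma> t \<noteq> id" using eq_iff[OF t permutes_id] by (simp add: idim)
  have "\<exists>c d. c \<noteq> d \<and> \<sigma> t = transpose c d"
  proof (rule ccontr)
    assume "\<not> ?thesis"
    then have not_transpose: "\<And>c d. c \<noteq> d \<Longrightarrow> \<sigma> t \<noteq> transpose c d" by blast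
    obtain g w where g: "g permutes {1..m}" and w: "w = \<sigma> t \<circ> (g \<circ> \<sigma> t \<circ> inv' g)"
      and order: "w \<circ> w \<noteq> id" "w \<circ> w \<circ> w \<noteq> id"
      by (rule involution_with_conjugate_product_order_ge_4[OF m perm[OF t] square nontrivial not_transpose])
    obtain h where h: "h permutes {1..m}" "\<sigma> h = g" using sym_group_iso_surj[OF \<sigma> g] by blast
    define v where "v = t \<circ> (h \<circ> t \<circ> inv' h)"
    have v: "v permutes {1..m}" using t h by (simp add: v_def permutes_compose permutes_inv)
    have "\<sigma> v = w"
      using t h by (simp add: v_def w comp permutes_compose permutes_inv sym_group_iso_inv[OF \<sigma>])
    then have "w \<circ> w = \<sigma> (v \<circ> v)" "w \<circ> w \<circ> w = \<sigma> (v \<circ> v \<circ> v)"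
      using v by (simp_all add: comp permutes_compose)
    moreover have "v \<circ> v = id \<or> v \<circ> v \<circ> v = id"
      unfolding v_def t_def permutes_conj_transpose[OF h(1)] by (rule transpose_product_order)
    ultimately show False using order idim by auto
  qed
  then show thesis using that unfolding t_def by blast
qed

lemma swapidseq_support:
  "swapidseq n p \<Longrightarrow> finite {x. p x \<noteq> x} \<and> card {x. p x \<noteq> x} \<le> 2 * n"
proof (induction rule: swapidseq.induct)
  case id
  then show ?case by simp
next
  case (comp_Suc n p a b)
  have sub: "{x. (transpose a b \<circ> p) x \<noteq> x} \<subseteq> {x. p x \<noteq> x} \<union> {a, b}"
    by (auto simp: transpose_def)
  have "card ({x. p x \<noteq> x} \<union> {a, b}) \<le> card {x. p x \<noteq> x} + card {a, b}" by (rule card_Un_le)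
  also have "\<dots> \<le> 2 * Suc n" using comp_Suc by (simp add: card_insert_if)
  finally show ?case
    using sub comp_Suc card_mono[OF _ sub] finite_subset[OF sub] by simp
qed

text \<open>The permutation \<open>(1 2)(3 4) \<dots> (2k-1 2k)\<close>.\<close>

definition matching_involution :: "nat \<Rightarrow> nat \<Rightarrow> nat" where
  "matching_involution k x =
     (if x \<in> {1..2 * k} then if odd x then x + 1 else x - 1 else x)"

lemma matching_involution_0: "matching_involution 0 = id"
  by (auto simp: matching_involution_def fun_eq_iff)

lemma matching_involution_Suc:
  "matching_involution (Suc k) = transpose (2 * k + 1) (2 * k + 2) \<circ> matching_involution k"
proof
  fix x
  consider "x = 2 * k + 1" | "x = 2 * k + 2" | "x \<notin> {2 * k + 1, 2 * k + 2}" by blast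
  then show "matching_involution (Suc k) x =
      (transpose (2 * k + 1) (2 * k + 2) \<circ> matching_involution k) x"
  proof cases
    case 3
    then have "matching_involution (Suc k) x = matching_involution k x"
      by (auto simp: matching_involution_def)
    moreover have "matching_involution k x \<notin> {2 * k + 1, 2 * k + 2}"
      using 3 by (auto simp: matching_involution_def elim!: oddE evenE)
    ultimately show ?thesis by simp
  qed (auto simp: matching_involution_def)
qed

lemma matching_involution_involution: "matching_involution k \<circ> matching_involution k = id"
  by (auto simp: matching_involution_def fun_eq_iff elim!: oddE evenE) presburger

lemma matching_involution_permutes: "2 * k \<le> m \<Longrightarrow> matching_involution k permutes {1..m}"
  by (induction k)
     (auto simp: matching_involution_0 matching_involution_Suc intro!: permutes_compose permutes_swap_id)

lemma matching_involution_swapidseq: "swapidseq k (matching_involution k)"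
proof (induction k)
  case 0
  show ?case by (simp only: matching_involution_0 swapidseq_id_iff)
next
  case (Suc k)
  have "2 * k + 1 \<noteq> 2 * k + 2" by simp
  then show ?case unfolding matching_involution_Suc using Suc.IH by (rule swapidseq.comp_Suc[rotated])
qed

lemma matching_involution_support: "{x. matching_involution k x \<noteq> x} = {1..2 * k}"
  by (auto simp: matching_involution_def)

text \<open>The image of a product of \<open>k\<close> transpositions is again a product of \<open>k\<close> transpositions and
  therefore moves at most \<open>2k\<close> points, whereas the involution for \<open>l\<close> moves \<open>2l\<close> points.\<close>

lemma sym_group_iso_matching_involution_le:
  assumes m: "m \<ge> 8" and \<sigma>: "\<sigma> \<in> iso (sym_group m) (sym_group m)" and k: "2 * k \<le> m"
    and image: "\<sigma> (matching_involution k) = matching_involution l"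
  shows "l \<le> k"
proof -
  have "swapidseq k (\<sigma> (matching_involution k))"
    using k
  proof (induction k)
    case 0
    then show ?case by (simp only: matching_involution_0 sym_group_iso_id[OF \<sigma>] swapidseq_id_iff)
  next
    case (Suc k)
    have in_range: "2 * k + 1 \<in> {1..m}" "2 * k + 2 \<in> {1..m}" using Suc.prems by auto
    obtain c d where cd: "c \<noteq> d" "\<sigma> (transpose (2 * k + 1) (2 * k + 2)) = transpose c d"
      using sym_group_iso_transpose[OF m \<sigma> in_range] by auto
    have "\<sigma> (matching_involution (Suc k)) = transpose c d \<circ> \<sigma> (matching_involution k)"
      unfolding matching_involution_Suc cd(2)[symmetric]
      using Suc.prems in_range
      by (intro sym_group_iso_comp[OF \<sigma>] permutes_swap_id matching_involution_permutes) auto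
    moreover have "swapidseq k (\<sigma> (matching_involution k))" using Suc by simp
    ultimately show ?case using swapidseq.comp_Suc[OF _ cd(1)] by (simp only:)
  qed
  from swapidseq_support[OF this] show ?thesis
    by (simp add: image matching_involution_support)
qed

section \<open>Representations of Cayley graphs\<close>

lemma cayley_digraph_wf:
  assumes "group G" "Y \<subseteq> carrier G"
  shows "wf_digraph (with_proj (cayley_digraph G Y))"
proof -
  interpret group G by fact
  show ?thesis
    using assms(2) by unfold_locales (auto simp: cayley_digraph_def)
qed

lemma cayley_digraph_isomorphism_of_bij:
  assumes "group G" and Y: "Y \<subseteq> carrier G"
    and \<phi>: "bij_betw \<phi> (carrier G) (carrier G)"
    and arcs: "map_prod \<phi> \<phi> ` parcs (cayley_digraph G Y) = parcs (cayley_digraph G Z)"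
  defines "f \<equiv> \<lparr>iso_verts = \<phi>, iso_arcs = map_prod \<phi> \<phi>, iso_head = snd, iso_tail = fst\<rparr>"
  shows "pre_digraph.digraph_isomorphism (with_proj (cayley_digraph G Y)) f"
    and "with_proj (cayley_digraph G Z) = app_iso f (with_proj (cayley_digraph G Y))"
proof -
  interpret wf_digraph "with_proj (cayley_digraph G Y)" by (rule cayley_digraph_wf) fact+
  have verts: "pverts (cayley_digraph G W) = carrier G" for W by (simp add: cayley_digraph_def)
  have "parcs (cayley_digraph G Y) \<subseteq> carrier G \<times> carrier G"
    using wellformed by (auto simp: verts)
  moreover have inj: "inj_on \<phi> (carrier G)" using \<phi> by (simp add: bij_betw_def)
  ultimately have "inj_on (map_prod \<phi> \<phi>) (parcs (cayley_digraph G Y))"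
    using map_prod_inj_on[OF inj inj] inj_on_subset by blast
  then show "digraph_isomorphism f"
    using inj wf_digraph_axioms by (simp add: digraph_isomorphism_def f_def verts)
  show "with_proj (cayley_digraph G Z) = app_iso f (with_proj (cayley_digraph G Y))"
    using \<phi> arcs by (simp add: app_iso_def f_def with_proj_def verts bij_betw_def)
qed

lemma cayley_equivalent_refl:
  assumes "group G" "Y \<subseteq> carrier G"
  shows "cayley_equivalent G (cayley_digraph G Y) (cayley_digraph G Y)"
proof -
  have bij: "bij_betw (\<lambda>x. x) (carrier G) (carrier G)" by (simp add: bij_betw_def)
  have arcs: "map_prod (\<lambda>x. x) (\<lambda>x. x) ` parcs (cayley_digraph G Y) = parcs (cayley_digraph G Y)"
    by (simp add: map_prod_ident)
  show ?thesis
    using cayley_digraph_isomorphism_of_bij[OF assms bij arcs]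
    unfolding cayley_equivalent_def by (intro exI conjI) (auto intro: iso_set_refl)
qed

text \<open>An automorphism fixes the identity, and the out-neighbours of the identity are exactly the
  elements of the connection set.\<close>

lemma cayley_equivalent_connection_sets:
  fixes G (structure)
  assumes "group G" and Y: "Y \<subseteq> carrier G" and Z: "Z \<subseteq> carrier G"
    and equiv: "cayley_equivalent G (cayley_digraph G Y) (cayley_digraph G Z)"
  obtains \<sigma> where "\<sigma> \<in> iso G G" "\<sigma> ` Y = Z"
proof -
  interpret group G by fact
  obtain f where \<sigma>: "iso_verts f \<in> iso G G"
    and f: "pre_digraph.digraph_isomorphism (with_proj (cayley_digraph G Y)) f"
    and Z_eq: "with_proj (cayley_digraph G Z) = app_iso f (with_proj (cayley_digraph G Y))"
    using equiv by (auto simp: cayley_equivalent_def)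
  define \<sigma> where "\<sigma> = iso_verts f"
  interpret \<sigma>: group_hom G G \<sigma>
    using \<sigma> group_axioms by (simp add: group_hom_def group_hom_axioms_def iso_def \<sigma>_def)
  have ends: "iso_tail f = fst" "iso_head f = snd"
    and arcs: "parcs (cayley_digraph G Z) = iso_arcs f ` parcs (cayley_digraph G Y)"
    using Z_eq by (simp_all add: app_iso_def with_proj_def)
  have arc: "iso_arcs f e = (\<sigma> (fst e), \<sigma> (snd e))" if "e \<in> parcs (cayley_digraph G Y)" for e
    using f that ends by (auto simp: pre_digraph.digraph_isomorphism_def \<sigma>_def prod_eq_iff)
  have out: "{y. (\<one>, y) \<in> parcs (cayley_digraph G W)} = W" if "W \<subseteq> carrier G" for W
    using that by (auto simp: cayley_digraph_def subset_iff) (metis r_one)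
  have inj: "inj_on \<sigma> (carrier G)" using \<sigma> by (simp add: iso_def bij_betw_def \<sigma>_def)
  have one_iff: "\<sigma> g = \<one> \<longleftrightarrow> g = \<one>" if "g \<in> carrier G" for g
    using inj_onD[OF inj, of g \<one>] \<sigma>.hom_one that by auto
  have "\<sigma> ` Y = Z"
  proof
    show "\<sigma> ` Y \<subseteq> Z"
    proof
      fix z assume "z \<in> \<sigma> ` Y"
      then obtain y where y: "y \<in> Y" "z = \<sigma> y" by blast
      then have "(\<one>, y) \<in> parcs (cayley_digraph G Y)" using out[OF Y] by blast
      then have "(\<one>, \<sigma> y) \<in> parcs (cayley_digraph G Z)" using arc arcs by force
      then show "z \<in> Z" using out[OF Z] y by blast
    qed
    show "Z \<subseteq> \<sigma> ` Y"
    proof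
      fix z assume "z \<in> Z"
      then have "(\<one>, z) \<in> parcs (cayley_digraph G Z)" using out[OF Z] by blast
      then obtain e where e: "e \<in> parcs (cayley_digraph G Y)" "(\<one>, z) = iso_arcs f e"
        using arcs by blast
      then have eq: "\<sigma> (fst e) = \<one>" "z = \<sigma> (snd e)" using arc by auto
      have "fst e \<in> carrier G" using e by (auto simp: cayley_digraph_def)
      then have "fst e = \<one>" using eq one_iff by blast
      then have "snd e \<in> Y" using out[OF Y] e by (cases e) auto
      then show "z \<in> \<sigma> ` Y" using eq by blast
    qed
  qed
  then show thesis using that \<sigma> \<sigma>_def by blast
qed

text \<open>The isomorphism leaves the even permutations alone and multiplies the odd ones by \<open>t\<close> on the
  left; it comes from a second regular action of the symmetric group on \<open>Cay(Sym(m), X)\<close>, in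
  which an odd element acts through right multiplication followed by left multiplication by \<open>t\<close>.
  Since every element of \<open>X\<close> is odd, each arc joins an even and an odd permutation, so exactly one of its ends is
  multiplied by \<open>t\<close>. An arc \<open>(g, txg)\<close> becomes \<open>(g, xg)\<close> for \<open>g\<close> even and, because \<open>t\<close> is an
  involution, \<open>(tg, (txt)(tg))\<close> for \<open>g\<close> odd; normality of \<open>X\<close> gives \<open>txt \<in> X\<close>.\<close>

lemma cayley_digraph_translate_iso:
  assumes X: "normal_subset X (sym_group m)" and odd: "\<And>x. x \<in> X \<Longrightarrow> \<not> evenperm x"
    and t: "t permutes {1..m}" "evenperm t" "t \<circ> t = id"
  shows "digraph_iso (with_proj (cayley_digraph (sym_group m) ((\<circ>) t ` X)))
           (with_proj (cayley_digraph (sym_group m) X))"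
proof -
  define \<phi> where "\<phi> g = (if evenperm g then g else t \<circ> g)" for g
  have X_perm: "x permutes {1..m}" if "x \<in> X" for x
    using X that by (auto simp: normal_subset_def sym_group_carrier)
  have even_comp: "evenperm (p \<circ> q) \<longleftrightarrow> evenperm p = evenperm q"
    if "p permutes {1..m}" "q permutes {1..m}" for p q
    using that by (intro evenperm_comp) (auto simp: permutation_permutes)
  have ttg: "t \<circ> (t \<circ> g) = g" for g using t(3) by (metis comp_assoc id_comp)
  have \<phi>\<phi>: "\<phi> (\<phi> g) = g" if "g permutes {1..m}" for g
    using that t by (auto simp: \<phi>_def even_comp ttg simp del: comp_apply)
  have \<phi>_perm: "\<phi> g permutes {1..m}" if "g permutes {1..m}" for g
    using that t by (simp add: \<phi>_def permutes_compose)
  have bij: "bij_betw \<phi> (carrier (sym_group m)) (carrier (sym_group m))"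
    by (rule bij_betw_byWitness[where f' = \<phi>])
       (auto simp: sym_group_carrier \<phi>\<phi> \<phi>_perm simp del: One_nat_def)
  have sub: "(\<circ>) t ` X \<subseteq> carrier (sym_group m)"
    using t X_perm by (auto simp: sym_group_carrier permutes_compose)
  have conj: "t \<circ> x \<circ> t \<in> X" if "x \<in> X" for x
    using normal_subset_conj[OF X that t(1)] inv_unique_comp[OF t(3) t(3)] by simp
  have arcs: "map_prod \<phi> \<phi> ` parcs (cayley_digraph (sym_group m) ((\<circ>) t ` X))
      = parcs (cayley_digraph (sym_group m) X)"
  proof
    show "map_prod \<phi> \<phi> ` parcs (cayley_digraph (sym_group m) ((\<circ>) t ` X))
      \<subseteq> parcs (cayley_digraph (sym_group m) X)"
    proof clarify
      fix g h assume "(g, h) \<in> parcs (cayley_digraph (sym_group m) ((\<circ>) t ` X))"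
      then obtain x where gx: "g permutes {1..m}" "x \<in> X" "h = (t \<circ> x) \<circ> g"
        by (auto simp: cayley_digraph_def sym_group_carrier sym_group_mult)
      have x: "x permutes {1..m}" "\<not> evenperm x" using gx odd X_perm by auto
      have "\<exists>x' \<in> X. \<phi> h = x' \<circ> \<phi> g"
      proof (cases "evenperm g")
        case True
        then have "\<not> evenperm h" using gx x t by (simp add: even_comp permutes_compose del: comp_apply)
        then have "\<phi> h = x \<circ> \<phi> g" using True gx by (simp add: \<phi>_def comp_assoc ttg)
        then show ?thesis using gx by blast
      next
        case False
        then have "evenperm h" using gx x t by (simp add: even_comp permutes_compose del: comp_apply)
        then have "\<phi> h = (t \<circ> x \<circ> t) \<circ> \<phi> g" using False gx by (simp add: \<phi>_def comp_assoc ttg)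
        then show ?thesis using conj gx by blast
      qed
      then show "(\<phi> g, \<phi> h) \<in> parcs (cayley_digraph (sym_group m) X)"
        using \<phi>_perm[OF gx(1)] by (auto simp: cayley_digraph_def sym_group_carrier sym_group_mult)
    qed
    show "parcs (cayley_digraph (sym_group m) X)
      \<subseteq> map_prod \<phi> \<phi> ` parcs (cayley_digraph (sym_group m) ((\<circ>) t ` X))"
    proof clarify
      fix g h assume "(g, h) \<in> parcs (cayley_digraph (sym_group m) X)"
      then obtain x where gx: "g permutes {1..m}" "x \<in> X" "h = x \<circ> g"
        by (auto simp: cayley_digraph_def sym_group_carrier sym_group_mult)
      have x: "x permutes {1..m}" "\<not> evenperm x" using gx odd X_perm by auto
      have h: "h permutes {1..m}" using gx x by (simp add: permutes_compose)
      have "\<exists>x' \<in> X. \<phi> h = (t \<circ> x') \<circ> \<phi> g"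
      proof (cases "evenperm g")
        case True
        then have "\<not> evenperm h" using gx x t by (simp add: even_comp permutes_compose del: comp_apply)
        then have "\<phi> h = (t \<circ> x) \<circ> \<phi> g" using True gx by (simp add: \<phi>_def comp_assoc)
        then show ?thesis using gx by blast
      next
        case False
        then have "evenperm h" using gx x t by (simp add: even_comp permutes_compose del: comp_apply)
        then have "\<phi> h = (t \<circ> (t \<circ> x \<circ> t)) \<circ> \<phi> g" using False gx by (simp add: \<phi>_def comp_assoc ttg)
        then show ?thesis using conj gx by blast
      qed
      then have "(\<phi> g, \<phi> h) \<in> parcs (cayley_digraph (sym_group m) ((\<circ>) t ` X))"
        using \<phi>_perm[OF gx(1)] by (auto simp: cayley_digraph_def sym_group_carrier sym_group_mult)
      then have "map_prod \<phi> \<phi> (\<phi> g, \<phi> h)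
          \<in> map_prod \<phi> \<phi> ` parcs (cayley_digraph (sym_group m) ((\<circ>) t ` X))"
        by (rule imageI)
      then show "(g, h) \<in> map_prod \<phi> \<phi> ` parcs (cayley_digraph (sym_group m) ((\<circ>) t ` X))"
        using \<phi>\<phi> gx h by simp
    qed
  qed
  show ?thesis
    unfolding digraph_iso_def
    using cayley_digraph_isomorphism_of_bij[OF sym_group_is_group sub bij arcs] by blast
qed

lemma finite_cayley_representations:
  assumes "finite (carrier G)"
  shows "finite (cayley_representations G \<Gamma>)"
proof -
  have "cayley_representations G \<Gamma> \<subseteq> cayley_digraph G ` Pow (carrier G)"
    by (auto simp: cayley_representations_def)
  then show ?thesis using assms finite_subset by blast
qed

text \<open>By reflexivity, two indices with the same class are equivalent in both directions. Finiteness
  of the group makes the quotient finite, so that its cardinality is not the value 0 given to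
  infinite sets.\<close>

lemma card_cayley_classes_ge:
  assumes "group G" and fin: "finite (carrier G)"
    and rep: "\<And>i. i \<in> I \<Longrightarrow> D i \<in> cayley_representations G \<Gamma>"
    and inequiv: "\<And>i j. i \<in> I \<Longrightarrow> j \<in> I \<Longrightarrow> cayley_equivalent G (D i) (D j)
      \<Longrightarrow> cayley_equivalent G (D j) (D i) \<Longrightarrow> i = j"
  shows "card I \<le> card (cayley_representations G \<Gamma> // cayley_equivalence G \<Gamma>)"
proof -
  let ?R = "cayley_representations G \<Gamma>" and ?E = "cayley_equivalence G \<Gamma>"
  have refl: "(D i, D i) \<in> ?E" if "i \<in> I" for i
  proof -
    from rep[OF \<open>i \<in> I\<close>] obtain Y where "D i = cayley_digraph G Y" "Y \<subseteq> carrier G"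
      by (auto simp: cayley_representations_def)
    then show ?thesis
      using rep[OF that] cayley_equivalent_refl[OF \<open>group G\<close>] by (simp add: cayley_equivalence_def)
  qed
  have "inj_on (\<lambda>i. ?E `` {D i}) I"
  proof (rule inj_onI)
    fix i j assume ij: "i \<in> I" "j \<in> I" and eq: "?E `` {D i} = ?E `` {D j}"
    then have "(D i, D j) \<in> ?E" "(D j, D i) \<in> ?E" using refl by blast+
    then show "i = j" using inequiv[OF ij] by (simp add: cayley_equivalence_def)
  qed
  moreover have "(\<lambda>i. ?E `` {D i}) ` I \<subseteq> ?R // ?E"
    using rep by (auto intro: quotientI)
  moreover have "finite (?R // ?E)"
    unfolding quotient_def using finite_cayley_representations[OF fin, of \<Gamma>] by simp
  ultimately show ?thesis by (rule card_inj_on_le)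
qed

section \<open>Counting inequivalent translates\<close>

lemma sym_group_iso_normal_subset:
  assumes \<sigma>: "\<sigma> \<in> iso (sym_group m) (sym_group m)" and X: "normal_subset X (sym_group m)"
  shows "normal_subset (\<sigma> ` X) (sym_group m)"
proof -
  have X_perm: "x permutes {1..m}" if "x \<in> X" for x
    using X that by (auto simp: normal_subset_def sym_group_carrier)
  have "(\<lambda>y. inv' g \<circ> y \<circ> g) ` \<sigma> ` X = \<sigma> ` X" if g: "g permutes {1..m}" for g
  proof -
    obtain h where h: "h permutes {1..m}" "\<sigma> h = g" using sym_group_iso_surj[OF \<sigma> g] by blast
    have "(\<lambda>y. inv' g \<circ> y \<circ> g) ` \<sigma> ` X = \<sigma> ` (\<lambda>x. inv' h \<circ> x \<circ> h) ` X"
      unfolding image_image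
      by (rule image_cong[OF refl])
         (simp add: sym_group_iso_comp[OF \<sigma>] sym_group_iso_inv[OF \<sigma>] h X_perm
           permutes_compose permutes_inv del: One_nat_def)
    also have "(\<lambda>x. inv' h \<circ> x \<circ> h) ` X = X"
      using X h by (simp add: normal_subset_def sym_group_carrier sym_group_mult)
    finally show ?thesis .
  qed
  then show ?thesis
    using X_perm sym_group_iso_permutes[OF \<sigma>]
    by (auto simp: normal_subset_def sym_group_carrier sym_group_mult)
qed

text \<open>The image of \<open>sX\<close> under an automorphism \<open>\<sigma>\<close> is \<open>\<sigma>(s)\<sigma>(X)\<close>, a translate of a set that is again
  normal but may differ from \<open>X\<close>. If this image is \<open>tX\<close>, uniqueness of the translating
  permutation gives \<open>\<sigma>(s) = t\<close>.\<close>

lemma cayley_equivalent_translates: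
  assumes m: "m \<ge> 5" and ne: "X \<noteq> {}"
    and sub: "X \<subset> carrier (sym_group m) - socle (sym_group m)"
    and X: "normal_subset X (sym_group m)"
    and s: "s permutes {1..m}" and t: "t permutes {1..m}"
    and equiv: "cayley_equivalent (sym_group m) (cayley_digraph (sym_group m) ((\<circ>) s ` X))
          (cayley_digraph (sym_group m) ((\<circ>) t ` X))"
  obtains \<sigma> where "\<sigma> \<in> iso (sym_group m) (sym_group m)" "\<sigma> s = t"
proof -
  have X_perm: "x permutes {1..m}" if "x \<in> X" for x
    using X that by (auto simp: normal_subset_def sym_group_carrier)
  have carrier: "(\<circ>) p ` X \<subseteq> carrier (sym_group m)" if "p permutes {1..m}" for p
    using that X_perm by (auto simp: sym_group_carrier permutes_compose)
  obtain \<sigma> where \<sigma>: "\<sigma> \<in> iso (sym_group m) (sym_group m)" and eq: "\<sigma> ` (\<circ>) s ` X = (\<circ>) t ` X"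
    using cayley_equivalent_connection_sets[OF sym_group_is_group carrier[OF s] carrier[OF t] equiv] by blast
  have "\<sigma> ` (\<circ>) s ` X = (\<circ>) (\<sigma> s) ` \<sigma> ` X"
    unfolding image_image
    by (rule image_cong[OF refl]) (simp add: sym_group_iso_comp[OF \<sigma>] s X_perm del: One_nat_def)
  then have "(\<circ>) t ` X = (\<circ>) (\<sigma> s) ` \<sigma> ` X" using eq by simp
  then have "t = \<sigma> s"
    using m left_stabilizer_trivial[OF m ne sub X] sym_group_iso_permutes[OF \<sigma> s]
    by (intro translate_of_normal_subset_unique[OF _ X sym_group_iso_normal_subset[OF \<sigma> X] _ t]) auto
  then show thesis using that \<sigma> by blast
qed

theorem corollary4p5:
  fixes m :: nat
    and G :: "(nat \<Rightarrow> nat) monoid"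
    and X :: "(nat \<Rightarrow> nat) set"
    and \<Gamma> :: "(nat \<Rightarrow> nat) pair_pre_digraph"
  assumes "m \<ge> 5"
    and "G = sym_group m"
    and "X \<noteq> {}"
    and "X \<subset> carrier G - socle G"
    and "set_inv\<^bsub>G\<^esub> X = X"
    and "normal_subset X G"
    and "\<Gamma> = cayley_digraph G X"
  shows "card (cayley_representations G \<Gamma> // cayley_equivalence G \<Gamma>) \<ge> m div 4"
proof -
  have sub: "X \<subset> carrier (sym_group m) - socle (sym_group m)"
    and X: "normal_subset X (sym_group m)"
    using assms(4,6) unfolding assms(2) .
  have odd: "x permutes {1..m} \<and> \<not> evenperm x" if "x \<in> X" for x
    using that sub by (intro outside_socle_odd[OF assms(1)]) blast
  \<comment> \<open>The factor 2 makes the involutions even.\<close>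
  define t where "t j = matching_involution (2 * j)" for j
  define D where "D j = cayley_digraph G ((\<circ>) (t j) ` X)" for j
  let ?I = "{1..m div 4}"
  have t_perm: "t j permutes {1..m}" if "j \<in> ?I" for j
    using that unfolding t_def by (intro matching_involution_permutes) auto
  have t_even: "evenperm (t j)" for j
    using evenperm_unique[OF matching_involution_swapidseq[of "2 * j"] refl] by (simp add: t_def)
  have rep: "D j \<in> cayley_representations G \<Gamma>" if j: "j \<in> ?I" for j
  proof -
    have "t j \<circ> x \<in> carrier G - {\<one>\<^bsub>G\<^esub>}" if "x \<in> X" for x
    proof -
      have "\<not> evenperm (t j \<circ> x)"
        using odd[OF that] t_perm[OF j] t_even[of j]
        by (subst evenperm_comp) (auto simp: permutation_permutes)
      then have "t j \<circ> x \<noteq> id" by (metis evenperm_id)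
      then show ?thesis
        using odd[OF that] t_perm[OF j] assms(2)
        by (simp add: sym_group_carrier sym_group_one permutes_compose del: id_apply comp_apply)
    qed
    then have "(\<circ>) (t j) ` X \<subseteq> carrier G - {\<one>\<^bsub>G\<^esub>}" by (rule image_subsetI)
    moreover have "digraph_iso (with_proj (D j)) (with_proj \<Gamma>)"
      unfolding D_def assms(2,7)
      using X odd t_perm[OF j] t_even matching_involution_involution
      by (intro cayley_digraph_translate_iso) (auto simp: t_def)
    ultimately show ?thesis
      unfolding cayley_representations_def D_def
      by (intro CollectI exI[of _ "(\<circ>) (t j) ` X"] conjI refl)
  qed
  have le: "j \<le> i" if ij: "i \<in> ?I" "j \<in> ?I" and equiv: "cayley_equivalent G (D i) (D j)" for i j
  proof (cases "m \<ge> 8")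
    case True
    obtain \<sigma> where \<sigma>: "\<sigma> \<in> iso (sym_group m) (sym_group m)" "\<sigma> (t i) = t j"
      by (rule cayley_equivalent_translates[OF assms(1,3) sub X t_perm[OF ij(1)] t_perm[OF ij(2)]
            equiv[unfolded D_def assms(2)]])
    have "2 * (2 * i) \<le> m" using ij by auto
    then have "2 * j \<le> 2 * i"
      by (rule sym_group_iso_matching_involution_le[OF True \<sigma>(1) _ \<sigma>(2)[unfolded t_def]])
    then show ?thesis by simp
  next
    case False
    \<comment> \<open>Here \<open>?I\<close> is \<open>{1}\<close>.\<close>
    then show ?thesis using ij by auto
  qed
  have "card ?I \<le> card (cayley_representations G \<Gamma> // cayley_equivalence G \<Gamma>)"
  proof (rule card_cayley_classes_ge)
    show "finite (carrier G)"
      by (simp add: assms(2) sym_group_def finite_permutations)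
    show "group G" by (simp add: assms(2) sym_group_is_group)
    show "i = j" if "i \<in> ?I" "j \<in> ?I"
      "cayley_equivalent G (D i) (D j)" "cayley_equivalent G (D j) (D i)" for i j
      using le that by (meson le_antisym)
  qed (use rep in auto)
  then show ?thesis by simp
qed

end
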